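(* For any integers $m,n\ge 2$, the Diestel-Leader graph $X=DL(m,n)$ is statistically hyperbolic, i.e. $E(X)$ exists and equals $2$.
   Context: Diestel-Leader graphs: for $m,n\ge 2$, let $T_1$ be the $(m+1)$-regular tree and $T_2$ the $(n+1)$-regular tree. Choose an end of each tree and the corresponding integer-valued horofunction (Busemann function), giving height functions $h_1$ on $T_1$ and $h_2$ on $T_2$, with signs chosen so that the chosen end of $T_1$ lies at height $-\infty$ and the chosen end of $T_2$ lies at height $+\infty$. Thus adjacent vertices differ in height by exactly $1$; every vertex of $T_1$ has exactly one neighbor below it and $m$ neighbors above it; every vertex of $T_2$ has exactly one neighbor above it and $n$ neighbors below it. $DL(m,n)$ is the subspace of $T_1\times T_2$ on which $h_1=h_2$; as a graph, its vertices are the pairs $(v_1,v_2)$ of vertices with $h_1(v_1)=h_2(v_2)$, and $(v_1,v_2)$, $(w_1,w_2)$ are adjacent iff $v_1$ is adjacent to $w_1$ in $T_1$ and $v_2$ is adjacent to $w_2$ in $T_2$. This graph is connected and vertex-transitive. For a locally finite vertex-transitive graph $X$ with path metric $d$ on vertices, let $S_k$ be the sphere of radius $k$ about a base vertex. The sprawl of $X$ is $E(X):=\lim_{k\to\infty}\frac{1}{|S_k|^2}\sum_{x,y\in S_k}\frac1k\,d(x,y)$, provided the limit exists. *)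

theory Defs
  imports Complex_Main
begin

definition simple_graph :: "'a set \<Rightarrow> 'a rel \<Rightarrow> bool" where
  "simple_graph V E \<longleftrightarrow> E \<subseteq> V \<times> V \<and> sym E \<and> irrefl E"

definition connected_graph :: "'a set \<Rightarrow> 'a rel \<Rightarrow> bool" where
  "connected_graph V E \<longleftrightarrow> V \<noteq> {} \<and> (\<forall>u\<in>V. \<forall>v\<in>V. (u, v) \<in> E\<^sup>*)"

definition is_cycle :: "'a rel \<Rightarrow> 'a list \<Rightarrow> bool" where
  "is_cycle E p \<longleftrightarrow> 3 \<le> length p \<and> distinct p \<and>
     (\<forall>i<length p. (p ! i, p ! (Suc i mod length p)) \<in> E)"

definition is_tree :: "'a set \<Rightarrow> 'a rel \<Rightarrow> bool" where
  "is_tree V E \<longleftrightarrow> simple_graph V E \<and> connected_graph V E \<and> (\<nexists>p. is_cycle E p)"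

text \<open>For positive \<open>d\<close>, the cardinality condition also says that neighbourhoods are finite.\<close>

definition regular_tree :: "'a set \<Rightarrow> 'a rel \<Rightarrow> nat \<Rightarrow> bool" where
  "regular_tree V E d \<longleftrightarrow> is_tree V E \<and> (\<forall>v\<in>V. card {w. (v, w) \<in> E} = d)"

text \<open>The path metric; the value is meaningful only if \<open>v\<close> is reachable from \<open>u\<close>.\<close>

definition graph_dist :: "'a rel \<Rightarrow> 'a \<Rightarrow> 'a \<Rightarrow> nat" where
  "graph_dist E u v = (LEAST l. (u, v) \<in> E ^^ l)"

text \<open>In a tree, every end is represented by an injective ray.\<close>

definition ray :: "'a set \<Rightarrow> 'a rel \<Rightarrow> (nat \<Rightarrow> 'a) \<Rightarrow> bool" where
  "ray V E r \<longleftrightarrow> inj r \<and> (\<forall>t. r t \<in> V \<and> (r t, r (Suc t)) \<in> E)"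

text \<open>The Busemann function of the end represented by \<open>r\<close>, which an end determines only up to
  an additive constant. It tends to minus infinity along \<open>r\<close>. The limit is taken in the discrete
  space of integers.\<close>

definition horofunction :: "'a set \<Rightarrow> 'a rel \<Rightarrow> (nat \<Rightarrow> 'a) \<Rightarrow> ('a \<Rightarrow> int) \<Rightarrow> bool" where
  "horofunction V E r h \<longleftrightarrow>
     (\<exists>c. \<forall>v\<in>V. (\<lambda>t. int (graph_dist E v (r t)) - int t) \<longlonglongrightarrow> h v + c)"

definition DL_verts :: "'a set \<Rightarrow> ('a \<Rightarrow> int) \<Rightarrow> 'b set \<Rightarrow> ('b \<Rightarrow> int) \<Rightarrow> ('a \<times> 'b) set" where
  "DL_verts V\<^sub>1 h\<^sub>1 V\<^sub>2 h\<^sub>2 = {(v\<^sub>1, v\<^sub>2). v\<^sub>1 \<in> V\<^sub>1 \<and> v\<^sub>2 \<in> V\<^sub>2 \<and> h\<^sub>1 v\<^sub>1 = h\<^sub>2 v\<^sub>2}"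

definition DL_edges ::
  "'a set \<Rightarrow> 'a rel \<Rightarrow> ('a \<Rightarrow> int) \<Rightarrow> 'b set \<Rightarrow> 'b rel \<Rightarrow> ('b \<Rightarrow> int) \<Rightarrow> ('a \<times> 'b) rel" where
  "DL_edges V\<^sub>1 E\<^sub>1 h\<^sub>1 V\<^sub>2 E\<^sub>2 h\<^sub>2 =
     {((v\<^sub>1, v\<^sub>2), (w\<^sub>1, w\<^sub>2)).
        (v\<^sub>1, v\<^sub>2) \<in> DL_verts V\<^sub>1 h\<^sub>1 V\<^sub>2 h\<^sub>2 \<and> (w\<^sub>1, w\<^sub>2) \<in> DL_verts V\<^sub>1 h\<^sub>1 V\<^sub>2 h\<^sub>2 \<and>
        (v\<^sub>1, w\<^sub>1) \<in> E\<^sub>1 \<and> (v\<^sub>2, w\<^sub>2) \<in> E\<^sub>2}"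

text \<open>Reachability is required so that the unspecified distance between different components of a
  disconnected graph plays no role.\<close>

definition graph_sphere :: "'a set \<Rightarrow> 'a rel \<Rightarrow> 'a \<Rightarrow> nat \<Rightarrow> 'a set" where
  "graph_sphere V E b k = {v \<in> V. (b, v) \<in> E\<^sup>* \<and> graph_dist E b v = k}"

definition sphere_average :: "'a set \<Rightarrow> 'a rel \<Rightarrow> 'a \<Rightarrow> nat \<Rightarrow> real" where
  "sphere_average V E b k =
     1 / (real (card (graph_sphere V E b k)))\<^sup>2 *
     (\<Sum>x\<in>graph_sphere V E b k. \<Sum>y\<in>graph_sphere V E b k. 1 / real k * real (graph_dist E x y))"

text \<open>In a vertex-transitive graph the averages do not depend on the base vertex \<open>b\<close>. Here the limit
  is required at every base vertex.\<close>

definition has_sprawl :: "'a set \<Rightarrow> 'a rel \<Rightarrow> real \<Rightarrow> bool" where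
  "has_sprawl V E L \<longleftrightarrow> V \<noteq> {} \<and> (\<forall>b\<in>V. sphere_average V E b \<longlonglongrightarrow> L)"

definition statistically_hyperbolic :: "'a set \<Rightarrow> 'a rel \<Rightarrow> bool" where
  "statistically_hyperbolic V E \<longleftrightarrow> has_sprawl V E 2"

end

theory Submission
  imports Defs
begin

text \<open>
  Write \<open>h\<close> for the height relative to the base vertex and \<open>M = max m n\<close>. Since \<open>d(x, y) \<le> 2k\<close> on
  the sphere \<open>S\<close> of radius \<open>k\<close>, it suffices that the defects \<open>2k - d(x, y)\<close> have bounded average. If
  \<open>h x \<ge> 0 \<ge> h y\<close>, then \<open>d(x, y) \<ge> h x - h y\<close>, so the defect is at most
  \<open>(k - \<bar>h x\<bar>) + (k - \<bar>h y\<bar>)\<close>. If both heights are nonnegative, projecting to the first tree gives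
  the additional term \<open>2t\<close>, where \<open>t\<close> is the positive part of the height at which the ancestral lines
  of \<open>x\<close> and \<open>y\<close> merge; two nonpositive heights are treated in the second tree, which is the same
  situation after exchanging the trees. The sphere has at least \<open>M ^ k\<close> points, because it contains all
  descendants of the base vertex at distance \<open>k\<close> in either tree. At most a constant times
  \<open>(i + 1)\<^sup>2 M ^ k (3/4) ^ i\<close> of its points have \<open>\<bar>h x\<bar> = k - i\<close>, and of those with \<open>h x \<ge> 0\<close> at most
  a constant times \<open>M ^ (k - j)\<close> have a prescribed ancestor at height \<open>j \<ge> 0\<close>. Both bounds are summable,
  so a point has bounded average depth \<open>k - \<bar>h x\<bar>\<close> and a pair has bounded average \<open>t\<close>.
\<close>

section \<open>Distances and horofunctions in trees\<close>

lemma graph_dist_le: "(u, v) \<in> E ^^ l \<Longrightarrow> graph_dist E u v \<le> l"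
  unfolding graph_dist_def by (rule Least_le)

lemma graph_dist_walk: "(u, v) \<in> E\<^sup>* \<Longrightarrow> (u, v) \<in> E ^^ graph_dist E u v"
  unfolding graph_dist_def by (rule LeastI_ex) (rule rtrancl_imp_relpow)

lemma graph_dist_eq_0: "(u, v) \<in> E\<^sup>* \<Longrightarrow> graph_dist E u v = 0 \<Longrightarrow> u = v"
  using graph_dist_walk[of u v E] by simp

lemma graph_dist_step_le:
  assumes "(u, v) \<in> E" "(v, z) \<in> E\<^sup>*"
  shows "graph_dist E u z \<le> Suc (graph_dist E v z)"
  by (rule graph_dist_le, rule relpow_Suc_I2[OF assms(1) graph_dist_walk[OF assms(2)]])

lemma graph_dist_closer_neighbour:
  assumes "(v, z) \<in> E\<^sup>*" "v \<noteq> z"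
  shows "\<exists>w. (v, w) \<in> E \<and> (w, z) \<in> E\<^sup>* \<and> Suc (graph_dist E w z) = graph_dist E v z"
proof -
  obtain l where l: "graph_dist E v z = Suc l"
    using graph_dist_eq_0[OF assms(1)] assms(2) not0_implies_Suc by blast
  with graph_dist_walk[OF assms(1)] obtain w where w: "(v, w) \<in> E" "(w, z) \<in> E ^^ l"
    by (metis relpow_Suc_D2)
  then have "(w, z) \<in> E\<^sup>*" using relpow_imp_rtrancl by blast
  with w l graph_dist_le[OF w(2)] graph_dist_step_le[OF w(1)] show ?thesis by force
qed

text \<open>Loop erasure: when the walk returns to a vertex of the path, the path is cut back to
  that vertex.\<close>

lemma distinct_walk:
  assumes "(a, b) \<in> R\<^sup>*"
  shows "\<exists>p. p \<noteq> [] \<and> hd p = a \<and> last p = b \<and> distinct p \<and>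
    (\<forall>i. Suc i < length p \<longrightarrow> (p ! i, p ! Suc i) \<in> R)"
  using assms
proof (induction rule: rtrancl_induct)
  case base
  show ?case by (rule exI[of _ "[a]"]) simp
next
  case (step y z)
  then obtain p where p: "p \<noteq> []" "hd p = a" "last p = y" "distinct p"
    "\<And>i. Suc i < length p \<Longrightarrow> (p ! i, p ! Suc i) \<in> R" by blast
  show ?case
  proof (cases "z \<in> set p")
    case True
    then obtain i where i: "i < length p" "p ! i = z" by (auto simp: in_set_conv_nth)
    have "length (take (Suc i) p) = Suc i" using i by simp
    then have "last (take (Suc i) p) = z" using i by (subst last_conv_nth) auto
    then show ?thesis using p i by (intro exI[of _ "take (Suc i) p"]) (auto simp: hd_take)
  next
    case False
    have "(p ! (length p - Suc 0), z) \<in> R" using p step(2) by (simp add: last_conv_nth)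
    then have "((p @ [z]) ! i, (p @ [z]) ! Suc i) \<in> R" if "Suc i < length (p @ [z])" for i
    proof (cases "Suc i = length p")
      case True
      then have "i = length p - Suc 0" by simp
      with \<open>(p ! (length p - Suc 0), z) \<in> R\<close> p(1) show ?thesis by (simp add: nth_append)
    next
      case False
      with that p(5) show ?thesis by (simp add: nth_append)
    qed
    with p False show ?thesis by (intro exI[of _ "p @ [z]"]) (simp add: hd_append)
  qed
qed

text \<open>A detour thins out to a path that misses \<open>v\<close>; adding \<open>v\<close>
  closes it to a cycle, of length at least 3 because \<open>w\<close> and \<open>w'\<close>
  differ.\<close>

lemma acyclic_no_detour:
  assumes "irrefl E" "sym E" "\<nexists>p. is_cycle E p" "(v, w) \<in> E" "(v, w') \<in> E" "w \<noteq> w'"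
  shows "(w, w') \<notin> {(a, b). (a, b) \<in> E \<and> a \<noteq> v \<and> b \<noteq> v}\<^sup>*" (is "_ \<notin> ?R\<^sup>*")
proof
  assume "(w, w') \<in> ?R\<^sup>*"
  from distinct_walk[OF this] obtain p where p: "p \<noteq> []" "hd p = w" "last p = w'" "distinct p"
    "\<And>i. Suc i < length p \<Longrightarrow> (p ! i, p ! Suc i) \<in> ?R" by blast
  have "w \<noteq> v" using assms by (auto simp: irrefl_def)
  have "p ! i \<noteq> v" if "i < length p" for i
    using that p(1,2) p(5)[of "i - 1"] \<open>w \<noteq> v\<close> by (cases i) (auto simp: hd_conv_nth)
  then have "v \<notin> set p" by (auto simp: in_set_conv_nth)
  have len: "2 \<le> length p"
    using p(1-3) assms(6) by (cases p; cases "tl p") auto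
  have "((v # p) ! i, (v # p) ! (Suc i mod length (v # p))) \<in> E" if i: "i < length (v # p)" for i
  proof (cases i)
    case 0
    then show ?thesis using p assms(4) by (auto simp: hd_conv_nth)
  next
    case (Suc j)
    show ?thesis
    proof (cases "Suc i = length (v # p)")
      case True
      then have "j = length p - 1" using Suc by simp
      then have "p ! j = w'" using p(1,3) by (simp add: last_conv_nth)
      then have "(v # p) ! i = w'" by (simp add: \<open>i = Suc j\<close>)
      moreover have "Suc i mod length (v # p) = 0" using True by simp
      ultimately show ?thesis using symD[OF assms(2,5)] by simp
    next
      case False
      then show ?thesis using Suc i p(5)[of j] by auto
    qed
  qed
  then have "is_cycle E (v # p)"
    using len \<open>v \<notin> set p\<close> p(4) unfolding is_cycle_def by simp
  with assms(3) show False by blast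
qed

text \<open>Distances to \<open>z\<close> strictly decrease along a shortest walk, so after
  \<open>w\<close> every vertex is closer to \<open>z\<close> than \<open>v\<close> is.\<close>

lemma geodesic_avoids:
  assumes "(w, z) \<in> E\<^sup>*" "graph_dist E w z \<le> graph_dist E v z" "w \<noteq> v"
  shows "(w, z) \<in> {(a, b). (a, b) \<in> E \<and> a \<noteq> v \<and> b \<noteq> v}\<^sup>*"
  using assms
proof (induction "graph_dist E w z" arbitrary: w)
  case 0
  then have "w = z" using graph_dist_eq_0[of w z E] by simp
  then show ?case by simp
next
  case (Suc l)
  show ?case
  proof (cases "w = z")
    case False
    from graph_dist_closer_neighbour[OF Suc.prems(1) this] obtain u where
      u: "(w, u) \<in> E" "(u, z) \<in> E\<^sup>*" "Suc (graph_dist E u z) = graph_dist E w z" by blast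
    then have "l = graph_dist E u z" using Suc.hyps(2) by simp
    moreover have "graph_dist E u z < graph_dist E v z" using u(3) Suc.prems(2) by linarith
    moreover from this have "u \<noteq> v" by blast
    ultimately have "(u, z) \<in> {(a, b). (a, b) \<in> E \<and> a \<noteq> v \<and> b \<noteq> v}\<^sup>*"
      using Suc.hyps(1) u(2) by simp
    moreover have "(w, u) \<in> {(a, b). (a, b) \<in> E \<and> a \<noteq> v \<and> b \<noteq> v}"
      using u(1) \<open>u \<noteq> v\<close> Suc.prems(3) by simp
    ultimately show ?thesis by (rule converse_rtrancl_into_rtrancl[rotated])
  qed simp
qed

text \<open>Two neighbours no farther from \<open>z\<close> than \<open>v\<close> would reach
  \<open>z\<close>, hence each other, without meeting \<open>v\<close>, which acyclicity
  forbids.\<close>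

lemma tree_neighbour_dist:
  assumes "is_tree V E" "v \<in> V" "z \<in> V" "v \<noteq> z"
  shows "\<exists>w. (v, w) \<in> E \<and> graph_dist E v z = Suc (graph_dist E w z) \<and>
    (\<forall>u. (v, u) \<in> E \<longrightarrow> u \<noteq> w \<longrightarrow> graph_dist E u z = Suc (graph_dist E v z))"
proof -
  have E: "sym E" "irrefl E" "E \<subseteq> V \<times> V" and acyc: "\<nexists>p. is_cycle E p"
    and conn: "\<And>u v. u \<in> V \<Longrightarrow> v \<in> V \<Longrightarrow> (u, v) \<in> E\<^sup>*"
    using assms(1) by (auto simp: is_tree_def simple_graph_def connected_graph_def)
  obtain w where w: "(v, w) \<in> E" "Suc (graph_dist E w z) = graph_dist E v z"
    using graph_dist_closer_neighbour[OF conn[OF assms(2,3)] assms(4)] by blast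
  have "graph_dist E u z = Suc (graph_dist E v z)" if u: "(v, u) \<in> E" "u \<noteq> w" for u
  proof (rule ccontr)
    let ?R = "{(a, b). (a, b) \<in> E \<and> a \<noteq> v \<and> b \<noteq> v}"
    assume "graph_dist E u z \<noteq> Suc (graph_dist E v z)"
    moreover have "graph_dist E u z \<le> Suc (graph_dist E v z)"
      using graph_dist_step_le[of u v] u E(1) conn assms by (blast dest: symD)
    ultimately have "graph_dist E u z \<le> graph_dist E v z" by simp
    moreover have "u \<in> V" "w \<in> V" "u \<noteq> v" "w \<noteq> v" using u w E by (auto simp: irrefl_def)
    ultimately have "(u, z) \<in> ?R\<^sup>*" "(w, z) \<in> ?R\<^sup>*"
      using w by (auto intro!: geodesic_avoids conn assms)
    moreover have "sym ?R" using E(1) by (auto simp: sym_def)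
    ultimately have "(u, w) \<in> ?R\<^sup>*" using rtrancl_trans[OF _ symD[OF sym_rtrancl]] by fast
    then show False using acyclic_no_detour[OF E(2,1) acyc u(1) w(1) u(2)] by contradiction
  qed
  with w show ?thesis by auto
qed

text \<open>Limits in the integers are eventually attained. As \<open>v\<close> has finitely many
  neighbours, a single \<open>t\<close> serves for all of them, and
  \<open>tree_neighbour_dist\<close> applies to \<open>z = r t\<close>.\<close>

lemma horofunction_neighbours:
  assumes "is_tree V E" "ray V E r" "horofunction V E r h" "v \<in> V" "finite {w. (v, w) \<in> E}"
  shows "\<exists>w. (v, w) \<in> E \<and> h w = h v - 1 \<and> (\<forall>u. (v, u) \<in> E \<longrightarrow> u \<noteq> w \<longrightarrow> h u = h v + 1)"
proof -
  obtain c where c: "\<And>u. u \<in> V \<Longrightarrow> (\<lambda>t. int (graph_dist E u (r t)) - int t) \<longlonglongrightarrow> h u + c"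
    using assms(3) by (auto simp: horofunction_def)
  have ev: "\<forall>\<^sub>F t in sequentially. int (graph_dist E u (r t)) - int t = h u + c" if "u \<in> V" for u
    using c[OF that] by (simp add: tendsto_discrete)
  have "E \<subseteq> V \<times> V" using assms(1) by (simp add: is_tree_def simple_graph_def)
  then have "\<forall>\<^sub>F t in sequentially. \<forall>u\<in>{w. (v, w) \<in> E}. int (graph_dist E u (r t)) - int t = h u + c"
    using assms(5) by (intro eventually_ball_finite ballI ev) auto
  moreover have "\<forall>\<^sub>F t in sequentially. v \<noteq> r t"
  proof (cases "v \<in> range r")
    case True
    then obtain s where "v = r s" by blast
    then have "v \<noteq> r t" if "t \<ge> Suc s" for t
      using assms(2) that by (auto simp: ray_def inj_eq)
    then show ?thesis using eventually_sequentially by blast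
  next
    case False
    then have "v \<noteq> r t" for t by blast
    then show ?thesis by simp
  qed
  ultimately have "\<forall>\<^sub>F t in sequentially. v \<noteq> r t \<and> int (graph_dist E v (r t)) - int t = h v + c \<and>
     (\<forall>u\<in>{w. (v, w) \<in> E}. int (graph_dist E u (r t)) - int t = h u + c)"
    using ev[OF assms(4)] by eventually_elim blast
  then obtain t where t: "v \<noteq> r t" "int (graph_dist E v (r t)) - int t = h v + c"
     "\<And>u. (v, u) \<in> E \<Longrightarrow> int (graph_dist E u (r t)) - int t = h u + c"
    using eventually_happens'[OF sequentially_bot] by blast
  have "r t \<in> V" using assms(2) by (simp add: ray_def)
  from tree_neighbour_dist[OF assms(1,4) this t(1)] obtain w where
    w: "(v, w) \<in> E" "graph_dist E v (r t) = Suc (graph_dist E w (r t))"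
    "\<And>u. (v, u) \<in> E \<Longrightarrow> u \<noteq> w \<Longrightarrow> graph_dist E u (r t) = Suc (graph_dist E v (r t))" by blast
  have "h w = h v - 1" using t(2) t(3)[OF w(1)] w(2) by linarith
  moreover have "h u = h v + 1" if "(v, u) \<in> E" "u \<noteq> w" for u
    using t(2) t(3)[OF that(1)] w(3)[OF that] by linarith
  ultimately show ?thesis using w(1) by blast
qed

section \<open>Trees with a distinguished end\<close>

text \<open>The parent \<open>p v\<close> is the neighbour of \<open>v\<close> towards the end, at which \<open>H\<close> tends to minus
  infinity. The second tree of a Diestel-Leader graph fits this pattern with \<open>H = - h\<^sub>2\<close>, so its
  vertices are the pairs with \<open>H\<^sub>1 + H\<^sub>2 = 0\<close> and the two factors play symmetric roles.\<close>

locale horo_tree =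
  fixes V :: "'a set" and p :: "'a \<Rightarrow> 'a" and H :: "'a \<Rightarrow> int" and q :: nat
  assumes parent_in [intro, simp]: "v \<in> V \<Longrightarrow> p v \<in> V"
    and height_parent [simp]: "v \<in> V \<Longrightarrow> H (p v) = H v - 1"
    and card_children: "v \<in> V \<Longrightarrow> card {w \<in> V. p w = v} = q"
    and q_ge: "2 \<le> q"

text \<open>The parent is the unique lower neighbour. An edge joining neither endpoint to its parent
  would raise the height in both directions.\<close>

lemma regular_tree_horo_tree:
  assumes "2 \<le> d" "regular_tree V E (d + 1)" "ray V E r" "horofunction V E r h"
  shows "\<exists>p. horo_tree V p h d \<and> (\<forall>v w. (v, w) \<in> E \<longleftrightarrow> v \<in> V \<and> w \<in> V \<and> (p v = w \<or> p w = v))"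
proof -
  have tree: "is_tree V E" and deg: "\<And>v. v \<in> V \<Longrightarrow> card {w. (v, w) \<in> E} = d + 1"
    using assms(2) by (auto simp: regular_tree_def)
  then have E: "sym E" "E \<subseteq> V \<times> V" by (auto simp: is_tree_def simple_graph_def)
  have fin: "finite {w. (v, w) \<in> E}" if "v \<in> V" for v
    using deg[OF that] card.infinite by fastforce
  have "\<forall>v\<in>V. \<exists>w. (v, w) \<in> E \<and> h w = h v - 1 \<and> (\<forall>u. (v, u) \<in> E \<longrightarrow> u \<noteq> w \<longrightarrow> h u = h v + 1)"
    using horofunction_neighbours[OF tree assms(3,4)] fin by blast
  from bchoice[OF this] obtain p where
    p: "\<And>v. v \<in> V \<Longrightarrow> (v, p v) \<in> E" "\<And>v. v \<in> V \<Longrightarrow> h (p v) = h v - 1"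
      "\<And>v u. (v, u) \<in> E \<Longrightarrow> u \<noteq> p v \<Longrightarrow> h u = h v + 1" using E(2) by blast
  have edge: "(v, w) \<in> E \<longleftrightarrow> v \<in> V \<and> w \<in> V \<and> (p v = w \<or> p w = v)" for v w
  proof
    assume vw: "(v, w) \<in> E"
    moreover have "p w = v" if "p v \<noteq> w"
    proof (rule ccontr)
      assume "p w \<noteq> v"
      then have "h v = h w + 1" using p(3)[of w v] vw E(1) by (auto dest: symD)
      moreover have "h w = h v + 1" using p(3)[of v w] vw that by auto
      ultimately show False by simp
    qed
    ultimately show "v \<in> V \<and> w \<in> V \<and> (p v = w \<or> p w = v)" using E(2) by blast
  next
    assume "v \<in> V \<and> w \<in> V \<and> (p v = w \<or> p w = v)"
    then show "(v, w) \<in> E" using p(1) E(1) by (blast dest: symD)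
  qed
  have pV: "p v \<in> V" if "v \<in> V" for v using p(1)[OF that] E(2) by blast
  have "card {w \<in> V. p w = v} = d" if v: "v \<in> V" for v
  proof -
    \<comment> \<open>Two parent steps lower the height by 2, so the parent is not a child; removing
      it from the \<open>d + 1\<close> neighbours leaves the children.\<close>
    have "p (p v) \<noteq> v" using p(2)[OF v] p(2)[OF pV[OF v]] by fastforce
    then have "w \<in> V \<and> p w = v \<longleftrightarrow> (v, w) \<in> E \<and> w \<noteq> p v" for w
      unfolding edge using v by auto
    then have "{w \<in> V. p w = v} = {w. (v, w) \<in> E} - {p v}" by fast
    then show ?thesis using deg[OF v] p(1)[OF v] by (simp add: card_Diff_singleton)
  qed
  then have "horo_tree V p h d" using pV p(2) assms(1) by unfold_locales
  with edge show ?thesis by blast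
qed

context horo_tree
begin

section \<open>Generations of descendants\<close>

definition desc :: "nat \<Rightarrow> 'a \<Rightarrow> 'a set" where
  "desc j v = {w \<in> V. (p ^^ j) w = v}"

lemma ancestor_in [simp]: "v \<in> V \<Longrightarrow> (p ^^ j) v \<in> V"
  by (induction j) auto

lemma height_ancestor [simp]: "v \<in> V \<Longrightarrow> H ((p ^^ j) v) = H v - int j"
  by (induction j) auto

lemma finite_card_desc:
  assumes "v \<in> V"
  shows "finite (desc j v) \<and> card (desc j v) = q ^ j"
proof (induction j)
  case 0
  have "desc 0 v = {v}" using assms by (auto simp: desc_def)
  then show ?case by simp
next
  case (Suc j)
  have eq: "desc (Suc j) v = (\<Union>u\<in>desc j v. {w \<in> V. p w = u})"
    by (auto simp: desc_def funpow_Suc_right simp del: funpow.simps)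
  \<comment> \<open>An infinite set has cardinality 0, so \<open>q \<ge> 2\<close> makes the sets of
    children finite.\<close>
  have c: "card {w \<in> V. p w = u} = q" "finite {w \<in> V. p w = u}" if "u \<in> V" for u
    using card_children[OF that] q_ge card.infinite[of "{w \<in> V. p w = u}"] by auto
  have d: "desc j v \<subseteq> V" by (auto simp: desc_def)
  have "card (desc (Suc j) v) = (\<Sum>u\<in>desc j v. card {w \<in> V. p w = u})"
    unfolding eq using Suc c d by (intro card_UN_disjoint) auto
  also have "\<dots> = (\<Sum>u\<in>desc j v. q)" using c d by (intro sum.cong) auto
  finally have "card (desc (Suc j) v) = q ^ Suc j" using Suc by simp
  moreover have "finite (desc (Suc j) v)" unfolding eq using Suc c d by auto
  ultimately show ?case by simp
qed

lemma finite_desc [simp]: "v \<in> V \<Longrightarrow> finite (desc j v)"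
  and card_desc: "v \<in> V \<Longrightarrow> card (desc j v) = q ^ j"
  using finite_card_desc[of v j] by simp_all

lemma desc_nonempty: "v \<in> V \<Longrightarrow> desc j v \<noteq> {}"
proof
  assume "v \<in> V" "desc j v = {}"
  then have "q ^ j = 0" using card_desc[of v j] by simp
  then show False using q_ge by simp
qed

lemma ex_height:
  assumes "v \<in> V"
  shows "\<exists>w\<in>V. H w = z"
proof (cases "z \<le> H v")
  case True
  then have "H ((p ^^ nat (H v - z)) v) = z" using assms by simp
  then show ?thesis using assms ancestor_in by blast
next
  case False
  obtain w where w: "w \<in> desc (nat (z - H v)) v" using desc_nonempty[OF assms] by blast
  then have "w \<in> V" "(p ^^ nat (z - H v)) w = v" by (auto simp: desc_def)
  then have "H w = z" using height_ancestor[of w "nat (z - H v)"] False by simp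
  with \<open>w \<in> V\<close> show ?thesis by blast
qed

end

section \<open>Counting points by height\<close>

text \<open>This is what a walk of length \<open>l\<close> from \<open>x\<close> to \<open>y\<close> leaves behind: it goes down to height
  \<open>h x - Q\<close> and up to height \<open>h x + P\<close>, which takes at least \<open>2Q + 2P - \<bar>h x - h y\<bar>\<close> steps.
  The primed numbers measure the same excursions from \<open>y\<close>.\<close>

definition linked :: "('a \<Rightarrow> 'a) \<Rightarrow> ('b \<Rightarrow> 'b) \<Rightarrow> nat \<Rightarrow> 'a \<times> 'b \<Rightarrow> 'a \<times> 'b \<Rightarrow> bool" where
  "linked p\<^sub>1 p\<^sub>2 l x y \<longleftrightarrow> (\<exists>Q Q' P P'. (p\<^sub>1 ^^ Q) (fst x) = (p\<^sub>1 ^^ Q') (fst y) \<and>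
     (p\<^sub>2 ^^ P) (snd x) = (p\<^sub>2 ^^ P') (snd y) \<and> Q + P = Q' + P' \<and>
     2 * int Q + 2 * int P \<le> int l + \<bar>int Q - int Q'\<bar>)"

text \<open>\<open>Q + P = Q' + P'\<close> gives
  \<open>\<bar>Q - Q'\<bar> = \<bar>P - P'\<bar>\<close>, so the length bound is symmetric in the
  two trees.\<close>

lemma linked_swap: "linked p\<^sub>1 p\<^sub>2 l x y \<Longrightarrow> linked p\<^sub>2 p\<^sub>1 l (prod.swap x) (prod.swap y)"
  unfolding linked_def fst_swap snd_swap
proof (elim exE conjE)
  fix Q Q' P P'
  assume *: "(p\<^sub>1 ^^ Q) (fst x) = (p\<^sub>1 ^^ Q') (fst y)" "(p\<^sub>2 ^^ P) (snd x) = (p\<^sub>2 ^^ P') (snd y)"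
    "Q + P = Q' + P'" "2 * int Q + 2 * int P \<le> int l + \<bar>int Q - int Q'\<bar>"
  have "P + Q = P' + Q' \<and> 2 * int P + 2 * int Q \<le> int l + \<bar>int P - int P'\<bar>"
    using *(3,4) by linarith
  with *(1,2) show "\<exists>Q Q' P P'. (p\<^sub>2 ^^ Q) (snd x) = (p\<^sub>2 ^^ Q') (snd y) \<and>
     (p\<^sub>1 ^^ P) (fst x) = (p\<^sub>1 ^^ P') (fst y) \<and> Q + P = Q' + P' \<and>
     2 * int Q + 2 * int P \<le> int l + \<bar>int Q - int Q'\<bar>" by blast
qed

lemma linked_refl: "linked p\<^sub>1 p\<^sub>2 0 x x"
  unfolding linked_def by (intro exI[of _ 0]) simp

text \<open>This is an upward step. If \<open>P' = 0\<close>, then \<open>y\<close> is at the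
  recorded top, and the step raises the top, so \<open>P\<close> grows; otherwise only
  \<open>P'\<close> drops by one.\<close>

lemma linked_step_fst:
  assumes "linked p\<^sub>1 p\<^sub>2 l x y" "p\<^sub>1 (fst z) = fst y" "p\<^sub>2 (snd y) = snd z"
  shows "linked p\<^sub>1 p\<^sub>2 (Suc l) x z"
proof -
  obtain Q Q' P P' where *: "(p\<^sub>1 ^^ Q) (fst x) = (p\<^sub>1 ^^ Q') (fst y)"
    "(p\<^sub>2 ^^ P) (snd x) = (p\<^sub>2 ^^ P') (snd y)"
    "Q + P = Q' + P'" "2 * int Q + 2 * int P \<le> int l + \<bar>int Q - int Q'\<bar>"
    using assms(1) unfolding linked_def by blast
  have 1: "(p\<^sub>1 ^^ Q) (fst x) = (p\<^sub>1 ^^ Suc Q') (fst z)"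
    using *(1) assms(2) by (simp add: funpow_Suc_right del: funpow.simps)
  show ?thesis
  proof (cases P')
    case 0
    then have "(p\<^sub>2 ^^ Suc P) (snd x) = (p\<^sub>2 ^^ 0) (snd z)" using *(2) assms(3) by simp
    moreover have "Q + Suc P = Suc Q' + 0"
      "2 * int Q + 2 * int (Suc P) \<le> int (Suc l) + \<bar>int Q - int (Suc Q')\<bar>" using *(3,4) 0 by auto
    ultimately show ?thesis unfolding linked_def using 1 by blast
  next
    case (Suc R)
    then have "(p\<^sub>2 ^^ P) (snd x) = (p\<^sub>2 ^^ R) (snd z)"
      using *(2) assms(3) by (simp add: funpow_Suc_right del: funpow.simps)
    moreover have "Q + P = Suc Q' + R"
      "2 * int Q + 2 * int P \<le> int (Suc l) + \<bar>int Q - int (Suc Q')\<bar>" using *(3,4) Suc by linarith+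
    ultimately show ?thesis unfolding linked_def using 1 by blast
  qed
qed

lemma linked_step_snd:
  assumes "linked p\<^sub>1 p\<^sub>2 l x y" "p\<^sub>1 (fst y) = fst z" "p\<^sub>2 (snd z) = snd y"
  shows "linked p\<^sub>1 p\<^sub>2 (Suc l) x z"
  using linked_swap[OF linked_step_fst[OF linked_swap[OF assms(1)], of "prod.swap z"]] assms(2,3)
  by simp

lemma relpow_linked:
  assumes "\<And>x y. (x, y) \<in> E \<Longrightarrow> p\<^sub>1 (fst y) = fst x \<and> p\<^sub>2 (snd x) = snd y \<or>
      p\<^sub>1 (fst x) = fst y \<and> p\<^sub>2 (snd y) = snd x"
    and "(x, y) \<in> E ^^ l"
  shows "linked p\<^sub>1 p\<^sub>2 l x y"
  using assms(2)
proof (induction l arbitrary: y)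
  case 0
  then show ?case by (simp add: linked_refl)
next
  case (Suc l)
  then obtain u where "(x, u) \<in> E ^^ l" "(u, y) \<in> E" by auto
  with Suc.IH assms(1) show ?case by (meson linked_step_fst linked_step_snd)
qed

section \<open>Exponential decay of the level sizes\<close>

lemma power_half_le:
  fixes M :: real
  assumes "2 \<le> M" "2 * e \<le> i"
  shows "M ^ (d + e) \<le> M ^ (d + i) * (3 / 4) ^ i"
proof -
  \<comment> \<open>The exponent \<open>i - e\<close> is at least \<open>i / 2\<close>, and 3/4
    exceeds the inverse square root of 2. To avoid roots the estimate is squared, with
    \<open>9/8 = 2 * (3/4)^2\<close>.\<close>
  have "1 \<le> (9 / 8 :: real) ^ i" by simp
  also have "\<dots> = 2 ^ i * ((3 / 4) ^ i)\<^sup>2" by (simp add: power_mult_distrib[symmetric] power2_eq_square)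
  also have "\<dots> \<le> 2 ^ (2 * (i - e)) * ((3 / 4) ^ i)\<^sup>2"
    using assms(2) by (intro mult_right_mono power_increasing) auto
  also have "\<dots> = (2 ^ (i - e) * (3 / 4) ^ i)\<^sup>2" by (simp add: power_mult_distrib power_mult[symmetric] mult.commute)
  finally have "1 \<le> (2 ^ (i - e) * (3 / 4) ^ i :: real)"
    using power2_le_imp_le[of 1 "2 ^ (i - e) * (3 / 4) ^ i :: real"] by simp
  also have "\<dots> \<le> M ^ (i - e) * (3 / 4) ^ i" using assms(1) by (intro mult_right_mono power_mono) auto
  finally have "M ^ (d + e) * 1 \<le> M ^ (d + e) * (M ^ (i - e) * (3 / 4) ^ i)"
    using assms(1) by (intro mult_left_mono) auto
  also have "\<dots> = M ^ (d + e + (i - e)) * (3 / 4) ^ i" by (simp add: power_add)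
  also have "d + e + (i - e) = d + i" using assms(2) by simp
  finally show ?thesis by simp
qed

text \<open>Up to the factor \<open>M ^ k\<close>, this bounds \<open>i\<close> times the number of points of height \<open>k - i\<close> in the
  sphere of radius \<open>k\<close>.\<close>

definition level_weight :: "nat \<Rightarrow> real" where
  "level_weight i = (real i + 1) ^ 3 * (3 / 4) ^ i"

lemma level_weight_nonneg: "0 \<le> level_weight i"
  by (simp add: level_weight_def)

lemma summable_level_weight: "summable level_weight"
\<comment> \<open>From \<open>i = 19\<close> on, \<open>(i + 2) / (i + 1) \<le> 21/20\<close>; the
  cube of 21/20 is below 6/5, and \<open>6/5 * 3/4 = 9/10\<close>.\<close>
proof (rule summable_ratio_test[of "9/10" 19])
  fix i :: nat assume "19 \<le> i"
  then have "real i + 2 \<le> 21 / 20 * (real i + 1)" by simp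
  then have "(real i + 2) ^ 3 \<le> (21 / 20 * (real i + 1)) ^ 3" by (intro power_mono) auto
  also have "\<dots> \<le> 6 / 5 * (real i + 1) ^ 3"
    unfolding power_mult_distrib by (intro mult_right_mono) (auto simp: power3_eq_cube)
  finally have "(real i + 2) ^ 3 * (3 / 4) ^ Suc i \<le> 6 / 5 * (real i + 1) ^ 3 * (3 / 4) ^ Suc i"
    by (intro mult_right_mono) auto
  then show "norm (level_weight (Suc i)) \<le> 9 / 10 * norm (level_weight i)"
    by (simp add: level_weight_def add_ac)
qed simp

lemma sum_level_weight_le: "(\<Sum>d\<le>k. level_weight (k - d)) \<le> suminf level_weight"
proof -
  have "(\<Sum>d\<le>k. level_weight (k - d)) = (\<Sum>i\<le>k. level_weight i)"
    by (rule sum.reindex_bij_witness[of _ "\<lambda>i. k - i" "\<lambda>i. k - i"]) auto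
  also have "\<dots> \<le> suminf level_weight"
    by (intro sum_le_suminf summable_level_weight) (auto simp: level_weight_nonneg)
  finally show ?thesis .
qed

section \<open>Counting points of nonnegative height\<close>

locale dl_based =
  T1: horo_tree V\<^sub>1 p\<^sub>1 H\<^sub>1 q\<^sub>1 + T2: horo_tree V\<^sub>2 p\<^sub>2 H\<^sub>2 q\<^sub>2
  for V\<^sub>1 :: "'a set" and p\<^sub>1 H\<^sub>1 q\<^sub>1 and V\<^sub>2 :: "'b set" and p\<^sub>2 H\<^sub>2 q\<^sub>2 +
  fixes b :: "'a \<times> 'b" and M :: real
  assumes base: "b \<in> V\<^sub>1 \<times> V\<^sub>2" "H\<^sub>1 (fst b) + H\<^sub>2 (snd b) = 0" and q_le: "real q\<^sub>1 \<le> M" "real q\<^sub>2 \<le> M"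
begin

lemma M_ge: "2 \<le> M"
  using q_le(1) T1.q_ge by linarith

definition ht :: "'a \<times> 'b \<Rightarrow> int" where
  "ht x = H\<^sub>1 (fst x) - H\<^sub>1 (fst b)"

text \<open>A superset of the ball of radius \<open>k\<close> that is described in terms of the trees alone.\<close>

definition reach :: "nat \<Rightarrow> ('a \<times> 'b) set" where
  "reach k = {x \<in> V\<^sub>1 \<times> V\<^sub>2. H\<^sub>1 (fst x) + H\<^sub>2 (snd x) = 0 \<and> linked p\<^sub>1 p\<^sub>2 k b x}"

text \<open>The common ancestor in the first tree ties the two heights together. Since
  \<open>\<bar>Q - Q'\<bar> = \<bar>P - P'\<bar> \<le> P + P'\<close>, the length bound yields
  \<open>Q + Q' \<le> l\<close>.\<close>

lemma linked_bounds:
  assumes "linked p\<^sub>1 p\<^sub>2 l x y" "x \<in> V\<^sub>1 \<times> V\<^sub>2" "y \<in> V\<^sub>1 \<times> V\<^sub>2"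
  shows "\<exists>Q Q'. (p\<^sub>1 ^^ Q) (fst x) = (p\<^sub>1 ^^ Q') (fst y) \<and> ht x - int Q = ht y - int Q' \<and> Q + Q' \<le> l"
    and "\<bar>ht x - ht y\<bar> \<le> int l"
proof -
  obtain Q Q' P P' where *: "(p\<^sub>1 ^^ Q) (fst x) = (p\<^sub>1 ^^ Q') (fst y)"
    "Q + P = Q' + P'" "2 * int Q + 2 * int P \<le> int l + \<bar>int Q - int Q'\<bar>"
    using assms(1) unfolding linked_def by blast
  have h: "ht x - int Q = ht y - int Q'"
    using arg_cong[OF *(1), of H\<^sub>1] assms(2,3) by (auto simp: ht_def)
  moreover have "Q + Q' \<le> l" using *(2,3) by linarith
  ultimately show "\<exists>Q Q'. (p\<^sub>1 ^^ Q) (fst x) = (p\<^sub>1 ^^ Q') (fst y) \<and> ht x - int Q = ht y - int Q' \<and> Q + Q' \<le> l"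
    using *(1) by blast
  show "\<bar>ht x - ht y\<bar> \<le> int l" using h \<open>Q + Q' \<le> l\<close> by linarith
qed

text \<open>\<open>Q\<close> is the dip below the base and \<open>c\<close> the overshoot above
  height \<open>d\<close>; both are paid for twice, the ascent of \<open>d\<close> once.\<close>

lemma reach_level:
  assumes "x \<in> reach k" "ht x = int d"
  shows "\<exists>Q c. d + 2 * (Q + c) \<le> k \<and> fst x \<in> T1.desc (Q + d) ((p\<^sub>1 ^^ Q) (fst b)) \<and>
    snd x \<in> T2.desc c ((p\<^sub>2 ^^ (c + d)) (snd b))"
proof -
  obtain Q Q' P P' where *: "(p\<^sub>1 ^^ Q) (fst b) = (p\<^sub>1 ^^ Q') (fst x)"
    "(p\<^sub>2 ^^ P) (snd b) = (p\<^sub>2 ^^ P') (snd x)"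
    "Q + P = Q' + P'" "2 * int Q + 2 * int P \<le> int k + \<bar>int Q - int Q'\<bar>"
    using assms(1) unfolding linked_def reach_def by blast
  have x: "fst x \<in> V\<^sub>1" "snd x \<in> V\<^sub>2" "fst b \<in> V\<^sub>1" using assms(1) base by (auto simp: reach_def)
  have "H\<^sub>1 (fst b) - int Q = H\<^sub>1 (fst x) - int Q'" using arg_cong[OF *(1), of H\<^sub>1] x by simp
  then have Q': "Q' = Q + d" and P: "P = P' + d" using assms(2) *(3) by (auto simp: ht_def)
  have "d + 2 * (Q + P') \<le> k" using *(4) Q' P by simp
  moreover have "fst x \<in> T1.desc (Q + d) ((p\<^sub>1 ^^ Q) (fst b))"
    using *(1) x Q' by (simp add: T1.desc_def)
  moreover have "snd x \<in> T2.desc P' ((p\<^sub>2 ^^ (P' + d)) (snd b))"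
    using *(2) x P by (simp add: T2.desc_def)
  ultimately show ?thesis by blast
qed

lemma ht_reach_le: "x \<in> reach k \<Longrightarrow> ht x \<le> int k"
  using reach_level[of x k "nat (ht x)"] by (cases "0 \<le> ht x") auto

lemma card_times_desc_le:
  assumes "v \<in> V\<^sub>1" "w \<in> V\<^sub>2"
  shows "real (card (T1.desc e v \<times> T2.desc c w)) \<le> M ^ (e + c)"
proof -
  have "real (card (T1.desc e v \<times> T2.desc c w)) = real q\<^sub>1 ^ e * real q\<^sub>2 ^ c"
    using assms by (simp add: card_cartesian_product T1.card_desc T2.card_desc)
  also have "\<dots> \<le> M ^ e * M ^ c" using q_le M_ge by (intro mult_mono power_mono) auto
  finally show ?thesis by (simp add: power_add)
qed

text \<open>A dip \<open>Q\<close> and an overshoot \<open>c\<close> leave at most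
  \<open>M ^ (d + Q + c)\<close> points, and there are at most \<open>(i + 1)^2\<close> such pairs.
  The factor \<open>k - d\<close> is the depth of each point and supplies the third power in
  \<open>level_weight\<close>.\<close>

lemma card_level_le:
  assumes "d \<le> k" "S \<subseteq> reach k"
  shows "real (k - d) * real (card {x \<in> S. ht x = int d}) \<le> M ^ k * level_weight (k - d)"
proof -
  define i where "i = k - d"
  define I where "I = {(Q, c). Q \<le> i \<and> c \<le> i \<and> 2 * (Q + c) \<le> i}"
  define F where "F = (\<lambda>(Q, c). T1.desc (Q + d) ((p\<^sub>1 ^^ Q) (fst b)) \<times>
    T2.desc c ((p\<^sub>2 ^^ (c + d)) (snd b)))"
  have b: "fst b \<in> V\<^sub>1" "snd b \<in> V\<^sub>2" using base by auto
  have I: "I \<subseteq> {..i} \<times> {..i}" by (auto simp: I_def)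
  then have finI: "finite I" by (rule finite_subset) simp
  have cardI: "real (card I) \<le> (real i + 1)\<^sup>2"
  proof -
    have "card I \<le> (i + 1)\<^sup>2"
      using card_mono[OF _ I] by (simp add: card_cartesian_product power2_eq_square)
    then have "real (card I) \<le> real ((i + 1)\<^sup>2)" by (rule of_nat_mono)
    then show ?thesis by (simp add: add.commute)
  qed
  have "{x \<in> S. ht x = int d} \<subseteq> (\<Union>z\<in>I. F z)"
  proof
    fix x assume x: "x \<in> {x \<in> S. ht x = int d}"
    then have "x \<in> reach k" "ht x = int d" using assms(2) by auto
    from reach_level[OF this] obtain Q c where
      "d + 2 * (Q + c) \<le> k" "fst x \<in> T1.desc (Q + d) ((p\<^sub>1 ^^ Q) (fst b))"
      "snd x \<in> T2.desc c ((p\<^sub>2 ^^ (c + d)) (snd b))" by blast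
    then have "(Q, c) \<in> I" "x \<in> F (Q, c)" by (auto simp: I_def i_def F_def mem_Times_iff)
    then show "x \<in> (\<Union>z\<in>I. F z)" by blast
  qed
  moreover have "finite (\<Union>z\<in>I. F z)" using finI b by (auto simp: F_def)
  ultimately have "card {x \<in> S. ht x = int d} \<le> (\<Sum>z\<in>I. card (F z))"
    using card_mono card_UN_le[OF finI, of F] le_trans by blast
  then have "real (card {x \<in> S. ht x = int d}) \<le> (\<Sum>z\<in>I. real (card (F z)))"
    by (simp flip: of_nat_sum)
  also have "\<dots> \<le> (\<Sum>z\<in>I. M ^ k * (3 / 4) ^ i)"
  proof (rule sum_mono)
    fix z assume "z \<in> I"
    then obtain Q c where z: "z = (Q, c)" "2 * (Q + c) \<le> i" by (auto simp: I_def)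
    have "real (card (F z)) \<le> M ^ (Q + d + c)"
      unfolding z(1) F_def prod.case using b by (intro card_times_desc_le) auto
    also have "Q + d + c = d + (Q + c)" by simp
    also have "M ^ (d + (Q + c)) \<le> M ^ (d + i) * (3 / 4) ^ i" by (rule power_half_le[OF M_ge z(2)])
    also have "d + i = k" using assms(1) by (simp add: i_def)
    finally show "real (card (F z)) \<le> M ^ k * (3 / 4) ^ i" .
  qed
  also have "\<dots> \<le> (real i + 1)\<^sup>2 * (M ^ k * (3 / 4) ^ i)"
    using cardI M_ge by (simp add: mult_right_mono)
  finally have "real i * real (card {x \<in> S. ht x = int d}) \<le> (real i + 1) * ((real i + 1)\<^sup>2 * (M ^ k * (3 / 4) ^ i))"
    by (intro mult_mono) auto
  also have "\<dots> = M ^ k * level_weight i" by (simp add: level_weight_def power2_eq_square power3_eq_cube)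
  finally show ?thesis by (simp add: i_def)
qed

text \<open>Once the ancestor at height \<open>j\<close> is \<open>v\<close>, the first coordinate
  has at most \<open>M ^ (d - j)\<close> values whatever the dip was, so only the overshoot
  \<open>c\<close> is summed over.\<close>

lemma card_level_above_le:
  assumes "j \<le> d" "d \<le> k" "S \<subseteq> reach k" "v \<in> V\<^sub>1"
  shows "real (card {x \<in> S. ht x = int d \<and> (p\<^sub>1 ^^ (d - j)) (fst x) = v}) \<le>
    M ^ k / M ^ j * level_weight (k - d)" (is "real (card ?A) \<le> _")
proof -
  define i where "i = k - d"
  define F where "F = (\<lambda>c. T1.desc (d - j) v \<times> T2.desc c ((p\<^sub>2 ^^ (c + d)) (snd b)))"
  have b: "snd b \<in> V\<^sub>2" using base by auto
  have "?A \<subseteq> (\<Union>c\<in>{..i div 2}. F c)"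
  proof
    fix x assume x: "x \<in> ?A"
    then have "x \<in> reach k" "ht x = int d" using assms(3) by auto
    from reach_level[OF this] obtain Q c where
      "d + 2 * (Q + c) \<le> k" "snd x \<in> T2.desc c ((p\<^sub>2 ^^ (c + d)) (snd b))" by blast
    moreover have "fst x \<in> T1.desc (d - j) v"
      using x \<open>x \<in> reach k\<close> by (auto simp: T1.desc_def reach_def)
    ultimately have "c \<le> i div 2" "x \<in> F c" by (auto simp: i_def F_def mem_Times_iff)
    then show "x \<in> (\<Union>c\<in>{..i div 2}. F c)" by blast
  qed
  moreover have "finite (\<Union>c\<in>{..i div 2}. F c)" using b assms(4) by (auto simp: F_def)
  ultimately have "card ?A \<le> (\<Sum>c\<le>i div 2. card (F c))"
    using card_mono card_UN_le[of "{..i div 2}" F] le_trans by blast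
  then have "real (card ?A) \<le> (\<Sum>c\<le>i div 2. real (card (F c)))"
    by (simp flip: of_nat_sum)
  also have "\<dots> \<le> (\<Sum>c\<le>i div 2. M ^ k / M ^ j * (3 / 4) ^ i)"
  proof (rule sum_mono)
    fix c assume "c \<in> {..i div 2}"
    then have c: "2 * c \<le> i" by simp
    have "real (card (F c)) \<le> M ^ (d - j + c)"
      unfolding F_def using b assms(4) by (intro card_times_desc_le) auto
    also have "\<dots> = M ^ (d + c) / M ^ j"
      using M_ge assms(1) by (simp add: power_diff power_add)
    also have "\<dots> \<le> M ^ (d + i) * (3 / 4) ^ i / M ^ j"
      using power_half_le[OF M_ge c] M_ge by (intro divide_right_mono) auto
    also have "d + i = k" using assms(2) by (simp add: i_def)
    finally show "real (card (F c)) \<le> M ^ k / M ^ j * (3 / 4) ^ i" by simp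
  qed
  also have "\<dots> = (real (i div 2) + 1) * (M ^ k / M ^ j * (3 / 4) ^ i)" by (simp add: add.commute)
  \<comment> \<open>The linear count is weakened to a cube so that \<open>level_weight\<close>
    serves both counts.\<close>
  also have "\<dots> \<le> (real i + 1) ^ 3 * (M ^ k / M ^ j * (3 / 4) ^ i)"
  proof (rule mult_right_mono)
    have "real (i div 2) + 1 \<le> (real i + 1) ^ 1" by simp
    also have "\<dots> \<le> (real i + 1) ^ 3" by (intro power_increasing) auto
    finally show "real (i div 2) + 1 \<le> (real i + 1) ^ 3" .
  qed (use M_ge in auto)
  also have "\<dots> = M ^ k / M ^ j * level_weight i" by (simp add: level_weight_def)
  finally show ?thesis by (simp add: i_def)
qed

lemma sum_defect_le:
  assumes "S \<subseteq> reach k" "finite S"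
  shows "(\<Sum>x\<in>{x \<in> S. 0 \<le> ht x}. real k - real_of_int (ht x)) \<le> M ^ k * suminf level_weight"
proof -
  have "(\<Sum>x\<in>{x \<in> S. 0 \<le> ht x}. real k - real_of_int (ht x)) =
    (\<Sum>d\<le>k. \<Sum>x\<in>{x \<in> {x \<in> S. 0 \<le> ht x}. nat (ht x) = d}. real k - real_of_int (ht x))"
    using assms ht_reach_le by (intro sum.group[symmetric]) force+
  also have "\<dots> = (\<Sum>d\<le>k. real (k - d) * real (card {x \<in> S. ht x = int d}))"
  proof (rule sum.cong[OF refl])
    fix d assume "d \<in> {..k}"
    moreover have "{x \<in> {x \<in> S. 0 \<le> ht x}. nat (ht x) = d} = {x \<in> S. ht x = int d}" by auto
    ultimately show "(\<Sum>x\<in>{x \<in> {x \<in> S. 0 \<le> ht x}. nat (ht x) = d}. real k - real_of_int (ht x)) =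
      real (k - d) * real (card {x \<in> S. ht x = int d})" by (simp add: of_nat_diff)
  qed
  also have "\<dots> \<le> (\<Sum>d\<le>k. M ^ k * level_weight (k - d))"
    using assms by (intro sum_mono card_level_le) auto
  also have "\<dots> \<le> M ^ k * suminf level_weight"
    unfolding sum_distrib_left[symmetric] using M_ge sum_level_weight_le
    by (intro mult_left_mono) auto
  finally show ?thesis .
qed

text \<open>The ancestor of the first coordinate at height \<open>j\<close>, provided
  \<open>j \<le> ht x\<close>. For larger \<open>j\<close> the truncation returns
  \<open>fst x\<close> itself, so \<open>common\<close> also demands
  \<open>j \<le> ht x\<close>.\<close>

definition anc :: "nat \<Rightarrow> 'a \<times> 'b \<Rightarrow> 'a" where
  "anc j x = (p\<^sub>1 ^^ nat (ht x - int j)) (fst x)"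

text \<open>The cardinality of this set is the height at which the ancestral lines of \<open>x\<close> and \<open>y\<close> in the
  first tree merge, or 0 if they merge below the base height.\<close>

definition common :: "nat \<Rightarrow> 'a \<times> 'b \<Rightarrow> 'a \<times> 'b \<Rightarrow> nat set" where
  "common k x y = {j \<in> {1..k}. int j \<le> ht x \<and> int j \<le> ht y \<and> anc j x = anc j y}"

lemma card_above_le:
  assumes "S \<subseteq> reach k" "finite S" "v \<in> V\<^sub>1"
  shows "real (card {y \<in> S. int j \<le> ht y \<and> anc j y = v}) \<le> M ^ k / M ^ j * suminf level_weight"
    (is "real (card ?A) \<le> _")
proof -
  let ?B = "\<lambda>d. {y \<in> S. ht y = int d \<and> (p\<^sub>1 ^^ (d - j)) (fst y) = v}"
  have "?A \<subseteq> (\<Union>d\<in>{j..k}. ?B d)"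
  proof
    fix y assume y: "y \<in> ?A"
    have "ht y \<le> int k" using ht_reach_le y assms(1) by blast
    moreover have "nat (ht y - int j) = nat (ht y) - j" by simp
    ultimately have "nat (ht y) \<in> {j..k}" "y \<in> ?B (nat (ht y))"
      using y by (auto simp: anc_def)
    then show "y \<in> (\<Union>d\<in>{j..k}. ?B d)" by blast
  qed
  moreover have "finite (\<Union>d\<in>{j..k}. ?B d)" using assms(2) by auto
  ultimately have "card ?A \<le> (\<Sum>d\<in>{j..k}. card (?B d))"
    using card_mono card_UN_le[of "{j..k}" ?B] le_trans by blast
  then have "real (card ?A) \<le> (\<Sum>d\<in>{j..k}. real (card (?B d)))"
    by (simp flip: of_nat_sum)
  also have "\<dots> \<le> (\<Sum>d\<in>{j..k}. M ^ k / M ^ j * level_weight (k - d))"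
    using assms by (intro sum_mono card_level_above_le) auto
  also have "\<dots> \<le> (\<Sum>d\<le>k. M ^ k / M ^ j * level_weight (k - d))"
    using M_ge by (intro sum_mono2) (auto simp: level_weight_nonneg)
  also have "\<dots> \<le> M ^ k / M ^ j * suminf level_weight"
    unfolding sum_distrib_left[symmetric] using M_ge sum_level_weight_le
    by (intro mult_left_mono) auto
  finally show ?thesis .
qed

text \<open>The sums are exchanged: for fixed \<open>x\<close>, each \<open>j\<close> counts the
  points \<open>y\<close> that share its ancestor at height \<open>j\<close>, and
  \<open>card_above_le\<close> bounds them with a saving of \<open>M ^ j\<close>.\<close>

lemma sum_common_le:
  assumes "S \<subseteq> reach k" "finite S"
  shows "(\<Sum>x\<in>S. \<Sum>y\<in>S. real (card (common k x y))) \<le> real (card S) * (M ^ k * suminf level_weight)"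
proof -
  let ?L = "suminf level_weight"
  have L: "0 \<le> ?L" using summable_level_weight level_weight_nonneg by (rule suminf_nonneg)
  \<comment> \<open>With \<open>M \<ge> 2\<close>, the geometric series started at
    \<open>j = 1\<close> sums to at most 1.\<close>
  have geom: "(\<Sum>j=1..k. 1 / M ^ j) \<le> 1"
  proof -
    have "(\<Sum>j=1..k. 1 / M ^ j) \<le> (\<Sum>j=1..k. 1 / 2 ^ j)"
      using M_ge by (intro sum_mono divide_left_mono power_mono) auto
    also have "\<dots> = 1 - 1 / 2 ^ k" by (induction k) (auto simp: field_simps)
    finally show ?thesis by (simp add: order_trans)
  qed
  have row: "(\<Sum>y\<in>S. real (card (common k x y))) \<le> M ^ k * ?L" if x: "x \<in> S" for x
  proof -
    have "real (card (common k x y)) =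
      (\<Sum>j=1..k. if int j \<le> ht x \<and> int j \<le> ht y \<and> anc j x = anc j y then 1 else 0)" for y
      unfolding common_def by (simp add: sum.If_cases Int_def)
    then have "(\<Sum>y\<in>S. real (card (common k x y))) =
      (\<Sum>j=1..k. \<Sum>y\<in>S. if int j \<le> ht x \<and> int j \<le> ht y \<and> anc j x = anc j y then 1 else 0)"
      by (simp add: sum.swap[of _ S])
    also have "\<dots> \<le> (\<Sum>j=1..k. M ^ k / M ^ j * ?L)"
    proof (rule sum_mono)
      fix j
      have v: "anc j x \<in> V\<^sub>1" using x assms(1) by (auto simp: anc_def reach_def)
      have "(\<Sum>y\<in>S. if int j \<le> ht x \<and> int j \<le> ht y \<and> anc j x = anc j y then 1 else 0) =
        real (card {y \<in> S. int j \<le> ht x \<and> int j \<le> ht y \<and> anc j x = anc j y})"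
        using assms(2) by (simp add: sum.If_cases Int_def)
      also have "\<dots> \<le> real (card {y \<in> S. int j \<le> ht y \<and> anc j y = anc j x})"
        using assms(2) by (intro of_nat_mono card_mono) auto
      also have "\<dots> \<le> M ^ k / M ^ j * ?L" by (rule card_above_le[OF assms v])
      finally show "(\<Sum>y\<in>S. if int j \<le> ht x \<and> int j \<le> ht y \<and> anc j x = anc j y then 1 else 0) \<le>
        M ^ k / M ^ j * ?L" .
    qed
    also have "\<dots> = M ^ k * ?L * (\<Sum>j=1..k. 1 / M ^ j)" by (simp add: sum_distrib_left)
    also have "\<dots> \<le> M ^ k * ?L * 1" using geom L M_ge by (intro mult_left_mono) auto
    finally show ?thesis by simp
  qed
  have "(\<Sum>x\<in>S. \<Sum>y\<in>S. real (card (common k x y))) \<le> (\<Sum>x\<in>S. M ^ k * ?L)"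
    by (rule sum_mono) (rule row)
  then show ?thesis by simp
qed

text \<open>A common ancestor at height \<open>t\<close> gives
  \<open>ht x + ht y = 2 * t + Q + Q'\<close> with \<open>Q + Q' \<le> l\<close>, and all heights
  from 1 to \<open>t\<close> belong to \<open>common k x y\<close>.\<close>

lemma ht_sum_le_common:
  assumes "linked p\<^sub>1 p\<^sub>2 l x y" "x \<in> reach k" "y \<in> reach k"
  shows "real_of_int (ht x + ht y) - 2 * real (card (common k x y)) \<le> real l"
proof -
  have V: "x \<in> V\<^sub>1 \<times> V\<^sub>2" "y \<in> V\<^sub>1 \<times> V\<^sub>2" using assms by (auto simp: reach_def)
  obtain Q Q' where Q: "(p\<^sub>1 ^^ Q) (fst x) = (p\<^sub>1 ^^ Q') (fst y)" "ht x - int Q = ht y - int Q'"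
    "Q + Q' \<le> l" using linked_bounds(1)[OF assms(1) V] by blast
  define t where "t = ht x - int Q"
  have "{1..nat t} \<subseteq> common k x y"
  proof
    fix j assume j: "j \<in> {1..nat t}"
    then have t: "int j \<le> t" by auto
    have eq: "nat (ht x - int j) = nat (t - int j) + Q" "nat (ht y - int j) = nat (t - int j) + Q'"
      using t Q(2) by (auto simp: t_def)
    have "anc j x = anc j y" unfolding anc_def eq by (simp add: funpow_add Q(1))
    moreover have "int j \<le> ht x" "int j \<le> ht y" using t Q(2) by (auto simp: t_def)
    moreover have "ht x \<le> int k" using ht_reach_le assms by blast
    ultimately show "j \<in> common k x y" using j by (auto simp: common_def)
  qed
  then have "nat t \<le> card (common k x y)"
    using card_mono[of "common k x y" "{1..nat t}"] by (simp add: common_def)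
  then have "t \<le> int (card (common k x y))" by linarith
  then have "ht x + ht y - 2 * int (card (common k x y)) \<le> int l" using Q(2,3) by (simp add: t_def)
  then show ?thesis by linarith
qed

end

section \<open>Pairs of points in a sphere\<close>

lemma relpow_sym:
  assumes "sym E" "(x, y) \<in> E ^^ l"
  shows "(y, x) \<in> E ^^ l"
  using assms(2)
proof (induction l arbitrary: y)
  case (Suc l)
  then obtain u where "(x, u) \<in> E ^^ l" "(u, y) \<in> E" by auto
  with Suc.IH symD[OF assms(1)] show ?case by (blast intro: relpow_Suc_I2)
qed simp

section \<open>Exchanging the trees and summing over pairs\<close>

context dl_based
begin

text \<open>On vertices the exchange negates \<open>ht\<close>, so bounds at nonnegative heights
  carry over to nonpositive ones.\<close>

lemma swapped: "dl_based V\<^sub>2 p\<^sub>2 H\<^sub>2 q\<^sub>2 V\<^sub>1 p\<^sub>1 H\<^sub>1 q\<^sub>1 (prod.swap b) M"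
  using base q_le by unfold_locales (auto simp: add.commute)

text \<open>The length bound forces \<open>Q + P \<le> k\<close>, so all four parameters are at most
  \<open>k\<close>, and each choice leaves finitely many points.\<close>

lemma finite_reach: "finite (reach k)"
proof -
  let ?F = "\<lambda>(Q, Q', P, P'). T1.desc Q' ((p\<^sub>1 ^^ Q) (fst b)) \<times> T2.desc P' ((p\<^sub>2 ^^ P) (snd b))"
  have "reach k \<subseteq> (\<Union>z\<in>{..k} \<times> {..k} \<times> {..k} \<times> {..k}. ?F z)"
  proof
    fix x assume x: "x \<in> reach k"
    then obtain Q Q' P P' where *: "(p\<^sub>1 ^^ Q) (fst b) = (p\<^sub>1 ^^ Q') (fst x)"
      "(p\<^sub>2 ^^ P) (snd b) = (p\<^sub>2 ^^ P') (snd x)"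
      "Q + P = Q' + P'" "2 * int Q + 2 * int P \<le> int k + \<bar>int Q - int Q'\<bar>"
      unfolding linked_def reach_def by blast
    then have "Q + P \<le> k" by linarith
    then have "(Q, Q', P, P') \<in> {..k} \<times> {..k} \<times> {..k} \<times> {..k}" using *(3) by auto
    moreover have "x \<in> ?F (Q, Q', P, P')"
      using * x by (auto simp: T1.desc_def T2.desc_def mem_Times_iff reach_def)
    ultimately show "x \<in> (\<Union>z\<in>{..k} \<times> {..k} \<times> {..k} \<times> {..k}. ?F z)" by (rule UN_I)
  qed
  moreover have "finite (\<Union>z\<in>{..k} \<times> {..k} \<times> {..k} \<times> {..k}. ?F z)"
    using base by (auto intro!: finite_cartesian_product T1.finite_desc T2.finite_desc)
  ultimately show ?thesis by (rule finite_subset)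
qed

text \<open>The defect of a pair is at most \<open>\<delta> x + \<delta> y + 2 * c x y\<close>. The
  counts bound the sum by a multiple of \<open>M ^ k * card S\<close>, and \<open>M ^ k\<close> is
  at most the size of \<open>S\<close>.\<close>

lemma sum_pair_defect_le:
  assumes S: "S \<subseteq> reach k" and card: "M ^ k \<le> real (card S)"
    and D: "\<And>x y. x \<in> S \<Longrightarrow> y \<in> S \<Longrightarrow> linked p\<^sub>1 p\<^sub>2 (D x y) x y"
  shows "(\<Sum>x\<in>S. \<Sum>y\<in>S. 2 * real k - real (D x y)) \<le> 8 * suminf level_weight * (real (card S))\<^sup>2"
proof -
  interpret sw: dl_based V\<^sub>2 p\<^sub>2 H\<^sub>2 q\<^sub>2 V\<^sub>1 p\<^sub>1 H\<^sub>1 q\<^sub>1 "prod.swap b" M by (rule swapped)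
  let ?L = "suminf level_weight"
  let ?N = "real (card S)"
  have L: "0 \<le> ?L" using summable_level_weight level_weight_nonneg by (rule suminf_nonneg)
  have finS: "finite S" using S finite_reach finite_subset by blast
  have inj: "inj_on prod.swap A" for A :: "('a \<times> 'b) set" by simp
  have sw_ht: "sw.ht (prod.swap x) = - ht x" if "x \<in> reach k" for x
    using that base by (auto simp: sw.ht_def ht_def reach_def)
  have sw_reach: "prod.swap x \<in> sw.reach k" if "x \<in> reach k" for x
    using that linked_swap[of p\<^sub>1 p\<^sub>2 k b x] by (auto simp: sw.reach_def reach_def mem_Times_iff)
  then have S': "prod.swap ` S \<subseteq> sw.reach k" using S by blast
  define \<delta> where "\<delta> x = real k - real_of_int \<bar>ht x\<bar>" for x
  define c where "c x y = real (card (common k x y)) +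
    real (card (sw.common k (prod.swap x) (prod.swap y)))" for x y
  have "(\<Sum>x\<in>{x \<in> S. ht x \<le> 0}. real k + real_of_int (ht x)) =
      (\<Sum>x\<in>{x \<in> prod.swap ` S. 0 \<le> sw.ht x}. real k - real_of_int (sw.ht x))"
    using S sw_ht by (intro sum.reindex_bij_witness[of _ prod.swap prod.swap]) (auto simp: subset_iff)
  also have "\<dots> \<le> M ^ k * ?L" using S' finS by (intro sw.sum_defect_le) auto
  finally have neg: "(\<Sum>x\<in>{x \<in> S. ht x \<le> 0}. real k + real_of_int (ht x)) \<le> M ^ k * ?L" .
  have \<delta>_nonneg: "0 \<le> \<delta> x" if "x \<in> S" for x
    using ht_reach_le[of x k] sw.ht_reach_le[OF sw_reach[of x]] sw_ht[of x] that S by (auto simp: \<delta>_def)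
  \<comment> \<open>Height 0 lies in both halves; counting it twice is harmless because
    \<open>\<delta>\<close> is nonnegative.\<close>
  have "(\<Sum>x\<in>S. \<delta> x) \<le> (\<Sum>x\<in>{x \<in> S. 0 \<le> ht x} \<union> {x \<in> S. ht x \<le> 0}. \<delta> x)"
    using finS by (intro eq_refl sum.cong) auto
  also have "\<dots> \<le> (\<Sum>x\<in>{x \<in> S. 0 \<le> ht x}. \<delta> x) + (\<Sum>x\<in>{x \<in> S. ht x \<le> 0}. \<delta> x)"
    using finS \<delta>_nonneg by (subst sum_Un) (auto intro!: sum_nonneg)
  also have "(\<Sum>x\<in>{x \<in> S. 0 \<le> ht x}. \<delta> x) = (\<Sum>x\<in>{x \<in> S. 0 \<le> ht x}. real k - real_of_int (ht x))"
    by (intro sum.cong) (auto simp: \<delta>_def)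
  also have "\<dots> \<le> M ^ k * ?L" by (rule sum_defect_le[OF S finS])
  also have "(\<Sum>x\<in>{x \<in> S. ht x \<le> 0}. \<delta> x) = (\<Sum>x\<in>{x \<in> S. ht x \<le> 0}. real k + real_of_int (ht x))"
    by (intro sum.cong) (auto simp: \<delta>_def)
  also note neg
  finally have sum_\<delta>: "(\<Sum>x\<in>S. \<delta> x) \<le> 2 * (M ^ k * ?L)" by (simp add: mult.commute)
  have "(\<Sum>x\<in>S. \<Sum>y\<in>S. real (card (sw.common k (prod.swap x) (prod.swap y)))) =
     (\<Sum>x\<in>prod.swap ` S. \<Sum>y\<in>prod.swap ` S. real (card (sw.common k x y)))"
    by (simp add: sum.reindex[OF inj])
  also have "\<dots> \<le> real (card (prod.swap ` S)) * (M ^ k * ?L)"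
    using S' finS by (intro sw.sum_common_le) auto
  also have "card (prod.swap ` S) = card S" by (rule card_image[OF inj])
  finally have sum_c: "(\<Sum>x\<in>S. \<Sum>y\<in>S. c x y) \<le> 2 * (?N * (M ^ k * ?L))"
    using sum_common_le[OF S finS] by (simp add: c_def sum.distrib)
  have "2 * real k - real (D x y) \<le> \<delta> x + \<delta> y + 2 * c x y" if xy: "x \<in> S" "y \<in> S" for x y
  proof -
    have r: "x \<in> reach k" "y \<in> reach k" using xy S by auto
    note up = ht_sum_le_common[OF D[OF xy] r]
    note down = sw.ht_sum_le_common[OF linked_swap[OF D[OF xy]] sw_reach[OF r(1)] sw_reach[OF r(2)],
        unfolded sw_ht[OF r(1)] sw_ht[OF r(2)]]
    have "\<bar>ht x - ht y\<bar> \<le> int (D x y)"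
      by (rule linked_bounds(2)[OF D[OF xy]]) (use r in \<open>auto simp: reach_def\<close>)
    then have mixed: "\<bar>real_of_int (ht x) - real_of_int (ht y)\<bar> \<le> real (D x y)" by linarith
    \<comment> \<open>Two points above the base are compared in the first tree (\<open>up\<close>),
      two below it in the second (\<open>down\<close>). On opposite sides the height difference is
      already \<open>\<bar>ht x\<bar> + \<bar>ht y\<bar>\<close> (\<open>mixed\<close>).\<close>
    show ?thesis
    proof (cases "0 \<le> ht x \<longleftrightarrow> 0 \<le> ht y")
      case True
      then show ?thesis using up down by (cases "0 \<le> ht x") (auto simp: \<delta>_def c_def)
    next
      case False
      then show ?thesis using mixed by (cases "0 \<le> ht x") (auto simp: \<delta>_def c_def)
    qed
  qed
  then have "(\<Sum>x\<in>S. \<Sum>y\<in>S. 2 * real k - real (D x y)) \<le> (\<Sum>x\<in>S. \<Sum>y\<in>S. \<delta> x + \<delta> y + 2 * c x y)"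
    by (intro sum_mono) auto
  also have "\<dots> = 2 * (?N * (\<Sum>x\<in>S. \<delta> x)) + 2 * (\<Sum>x\<in>S. \<Sum>y\<in>S. c x y)"
    by (simp add: sum.distrib sum_distrib_left)
  \<comment> \<open>The constant 8 is 4 from the depths (two points, two signs) plus 4 from merging
    (factor 2, two trees).\<close>
  also have "\<dots> \<le> 2 * (?N * (2 * (M ^ k * ?L))) + 2 * (2 * (?N * (M ^ k * ?L)))"
    using sum_\<delta> sum_c by (intro add_mono mult_left_mono) auto
  also have "\<dots> = M ^ k * (8 * ?L * ?N)" by simp
  also have "\<dots> \<le> ?N * (8 * ?L * ?N)" using card L by (intro mult_right_mono) auto
  finally show ?thesis by (simp add: power2_eq_square mult_ac)
qed

end

section \<open>Edges, extreme points and averages over spheres\<close>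

locale dl_graph = dl_based +
  fixes E :: "('a \<times> 'b) rel"
  assumes edge_iff: "(x, y) \<in> E \<longleftrightarrow>
    x \<in> V\<^sub>1 \<times> V\<^sub>2 \<and> y \<in> V\<^sub>1 \<times> V\<^sub>2 \<and> H\<^sub>1 (fst x) + H\<^sub>2 (snd x) = 0 \<and> H\<^sub>1 (fst y) + H\<^sub>2 (snd y) = 0 \<and>
    (p\<^sub>1 (fst y) = fst x \<and> p\<^sub>2 (snd x) = snd y \<or> p\<^sub>1 (fst x) = fst y \<and> p\<^sub>2 (snd y) = snd x)"
begin

abbreviation verts :: "('a \<times> 'b) set" where
  "verts \<equiv> {x \<in> V\<^sub>1 \<times> V\<^sub>2. H\<^sub>1 (fst x) + H\<^sub>2 (snd x) = 0}"

lemma sym_E: "sym E"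
  by (rule symI) (auto simp: edge_iff)

lemma walk_linked: "(x, y) \<in> E ^^ l \<Longrightarrow> linked p\<^sub>1 p\<^sub>2 l x y"
  by (rule relpow_linked[of E]) (auto simp: edge_iff)

text \<open>An ascending walk: the first coordinate follows the line of descent to \<open>x\<close>
  while the second moves through parents.\<close>

lemma walk_up: "x \<in> T1.desc l (fst b) \<Longrightarrow> (b, (x, (p\<^sub>2 ^^ l) (snd b))) \<in> E ^^ l"
proof (induction l arbitrary: x)
  case 0
  then show ?case by (cases b) (simp add: T1.desc_def)
next
  case (Suc l)
  then have x: "x \<in> V\<^sub>1" "(p\<^sub>1 ^^ l) (p\<^sub>1 x) = fst b"
    by (auto simp: T1.desc_def funpow_Suc_right simp del: funpow.simps)
  have "H\<^sub>1 x = H\<^sub>1 (fst b) + int l + 1"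
    using arg_cong[OF x(2), of H\<^sub>1] x(1) by simp
  then have "((p\<^sub>1 x, (p\<^sub>2 ^^ l) (snd b)), (x, (p\<^sub>2 ^^ Suc l) (snd b))) \<in> E"
    using x(1) base by (auto simp: edge_iff mem_Times_iff)
  moreover have "(b, (p\<^sub>1 x, (p\<^sub>2 ^^ l) (snd b))) \<in> E ^^ l"
    using x by (intro Suc.IH) (simp add: T1.desc_def)
  ultimately show ?case by auto
qed

lemma walk_down: "y \<in> T2.desc l (snd b) \<Longrightarrow> (b, ((p\<^sub>1 ^^ l) (fst b), y)) \<in> E ^^ l"
proof (induction l arbitrary: y)
  case 0
  then show ?case by (cases b) (simp add: T2.desc_def)
next
  case (Suc l)
  then have y: "y \<in> V\<^sub>2" "(p\<^sub>2 ^^ l) (p\<^sub>2 y) = snd b"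
    by (auto simp: T2.desc_def funpow_Suc_right simp del: funpow.simps)
  have "H\<^sub>2 y = H\<^sub>2 (snd b) + int l + 1"
    using arg_cong[OF y(2), of H\<^sub>2] y(1) by simp
  then have "(((p\<^sub>1 ^^ l) (fst b), p\<^sub>2 y), ((p\<^sub>1 ^^ Suc l) (fst b), y)) \<in> E"
    using y(1) base by (auto simp: edge_iff mem_Times_iff)
  moreover have "(b, ((p\<^sub>1 ^^ l) (fst b), p\<^sub>2 y)) \<in> E ^^ l"
    using y by (intro Suc.IH) (simp add: T2.desc_def)
  ultimately show ?case by auto
qed

abbreviation sph :: "nat \<Rightarrow> ('a \<times> 'b) set" where
  "sph \<equiv> graph_sphere verts E b"

lemma sph_subset_reach: "sph k \<subseteq> reach k"
proof
  fix x assume x: "x \<in> sph k"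
  then have "linked p\<^sub>1 p\<^sub>2 (graph_dist E b x) b x"
    by (intro walk_linked graph_dist_walk) (simp add: graph_sphere_def)
  with x show "x \<in> reach k" by (simp add: graph_sphere_def reach_def)
qed

text \<open>A walk changes the height by at most its length, so a walk of length \<open>k\<close> to
  relative height \<open>k\<close> or \<open>- k\<close> is shortest.\<close>

lemma extreme_in_sph:
  assumes "(b, x) \<in> E ^^ k" "x \<in> verts" "\<bar>ht x\<bar> = int k"
  shows "x \<in> sph k"
proof -
  have conn: "(b, x) \<in> E\<^sup>*" using assms(1) by (rule relpow_imp_rtrancl)
  have "\<bar>ht b - ht x\<bar> \<le> int (graph_dist E b x)"
    using walk_linked[OF graph_dist_walk[OF conn]] base assms(2) by (intro linked_bounds(2)) auto
  moreover have "ht b = 0" by (simp add: ht_def)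
  ultimately have "k \<le> graph_dist E b x" using assms(3) by simp
  then show ?thesis using graph_dist_le[OF assms(1)] conn assms(2) by (simp add: graph_sphere_def)
qed

lemma card_sph_ge: "q\<^sub>1 ^ k \<le> card (sph k)" "q\<^sub>2 ^ k \<le> card (sph k)"
proof -
  have fin: "finite (sph k)" using sph_subset_reach finite_reach finite_subset by blast
  have b: "fst b \<in> V\<^sub>1" "snd b \<in> V\<^sub>2" using base by auto
  have "x \<in> sph k" if "x \<in> T1.desc k (fst b) \<times> {(p\<^sub>2 ^^ k) (snd b)}" for x
  proof -
    have x: "fst x \<in> T1.desc k (fst b)" "snd x = (p\<^sub>2 ^^ k) (snd b)" using that by auto
    then have x1: "fst x \<in> V\<^sub>1" "(p\<^sub>1 ^^ k) (fst x) = fst b" by (auto simp: T1.desc_def)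
    have h: "H\<^sub>1 (fst x) = H\<^sub>1 (fst b) + int k" using arg_cong[OF x1(2), of H\<^sub>1] x1(1) by simp
    have h2: "H\<^sub>2 (snd x) = H\<^sub>2 (snd b) - int k" using x(2) b(2) by simp
    have V2: "snd x \<in> V\<^sub>2" using x(2) b(2) by simp
    have "(fst x, (p\<^sub>2 ^^ k) (snd b)) = x" by (simp only: x(2)[symmetric] prod.collapse)
    then have "(b, x) \<in> E ^^ k" using walk_up[OF x(1)] by (simp only:)
    then show ?thesis
      by (rule extreme_in_sph) (use x1(1) V2 h h2 base(2) in \<open>simp_all add: ht_def mem_Times_iff\<close>)
  qed
  then have "card (T1.desc k (fst b) \<times> {(p\<^sub>2 ^^ k) (snd b)}) \<le> card (sph k)"
    using fin by (intro card_mono subsetI) auto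
  then show "q\<^sub>1 ^ k \<le> card (sph k)" using T1.card_desc[OF b(1)] by (simp add: card_cartesian_product)
  have "x \<in> sph k" if "x \<in> {(p\<^sub>1 ^^ k) (fst b)} \<times> T2.desc k (snd b)" for x
  proof -
    have x: "snd x \<in> T2.desc k (snd b)" "fst x = (p\<^sub>1 ^^ k) (fst b)" using that by auto
    then have x2: "snd x \<in> V\<^sub>2" "(p\<^sub>2 ^^ k) (snd x) = snd b" by (auto simp: T2.desc_def)
    have h: "H\<^sub>2 (snd x) = H\<^sub>2 (snd b) + int k" using arg_cong[OF x2(2), of H\<^sub>2] x2(1) by simp
    have h1: "H\<^sub>1 (fst x) = H\<^sub>1 (fst b) - int k" using x(2) b(1) by simp
    have V1: "fst x \<in> V\<^sub>1" using x(2) b(1) by simp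
    have "((p\<^sub>1 ^^ k) (fst b), snd x) = x" by (simp only: x(2)[symmetric] prod.collapse)
    then have "(b, x) \<in> E ^^ k" using walk_down[OF x(1)] by (simp only:)
    then show ?thesis
      by (rule extreme_in_sph) (use x2(1) V1 h h1 base(2) in \<open>simp_all add: ht_def mem_Times_iff\<close>)
  qed
  then have "card ({(p\<^sub>1 ^^ k) (fst b)} \<times> T2.desc k (snd b)) \<le> card (sph k)"
    using fin by (intro card_mono subsetI) auto
  then show "q\<^sub>2 ^ k \<le> card (sph k)" using T2.card_desc[OF b(2)] by (simp add: card_cartesian_product)
qed

lemma sphere_average_bounds:
  assumes M: "M = max (real q\<^sub>1) (real q\<^sub>2)" and k: "0 < k"
  shows "2 - 8 * suminf level_weight / real k \<le> sphere_average verts E b k"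
    and "sphere_average verts E b k \<le> 2"
proof -
  let ?S = "sph k" and ?D = "\<lambda>x y. graph_dist E x y"
  let ?N = "real (card ?S)" and ?L = "suminf level_weight"
  have cardM: "M ^ k \<le> ?N"
    using card_sph_ge[of k] unfolding M by (simp add: max_def flip: of_nat_power)
  then have N: "0 < ?N" using M_ge by (smt (verit) zero_less_power)
  have D: "(x, y) \<in> E ^^ ?D x y \<and> ?D x y \<le> 2 * k" if "x \<in> ?S" "y \<in> ?S" for x y
  proof -
    have "(b, x) \<in> E ^^ k" "(b, y) \<in> E ^^ k"
      using that graph_dist_walk[of b x E] graph_dist_walk[of b y E]
      by (simp_all add: graph_sphere_def)
    \<comment> \<open>Reversing one of the walks joins \<open>x\<close> to \<open>y\<close> through
      \<open>b\<close>; this gives reachability as well as the distance bound.\<close>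
    then have *: "(x, y) \<in> E ^^ (k + k)" unfolding relpow_add using relpow_sym[OF sym_E] by blast
    then show ?thesis
      using graph_dist_le[OF *] graph_dist_walk[OF relpow_imp_rtrancl[OF *]] by simp
  qed
  have avg: "sphere_average verts E b k = (\<Sum>x\<in>?S. \<Sum>y\<in>?S. real (?D x y)) / (?N\<^sup>2 * real k)"
    by (simp add: sphere_average_def sum_divide_distrib[symmetric])
  have two: "(\<Sum>x\<in>?S. \<Sum>y\<in>?S. 2 * real k) = 2 * (?N\<^sup>2 * real k)" by (simp add: power2_eq_square)
  have pos: "0 < ?N\<^sup>2 * real k" using N k by simp
  have "(\<Sum>x\<in>?S. \<Sum>y\<in>?S. real (?D x y)) \<le> (\<Sum>x\<in>?S. \<Sum>y\<in>?S. 2 * real k)"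
  proof (intro sum_mono)
    fix x y assume "x \<in> ?S" "y \<in> ?S"
    then have "?D x y \<le> 2 * k" using D by blast
    then show "real (?D x y) \<le> 2 * real k" by linarith
  qed
  then show "sphere_average verts E b k \<le> 2" unfolding avg two using pos by (simp add: pos_divide_le_eq)
  have "(\<Sum>x\<in>?S. \<Sum>y\<in>?S. 2 * real k - real (?D x y)) \<le> 8 * ?L * ?N\<^sup>2"
    by (rule sum_pair_defect_le[OF sph_subset_reach cardM]) (use D walk_linked in blast)
  then have "2 * (?N\<^sup>2 * real k) - 8 * ?L * ?N\<^sup>2 \<le> (\<Sum>x\<in>?S. \<Sum>y\<in>?S. real (?D x y))"
    unfolding sum_subtractf two by simp
  moreover have "2 * (?N\<^sup>2 * real k) - 8 * ?L * ?N\<^sup>2 = (2 - 8 * ?L / real k) * (?N\<^sup>2 * real k)"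
    using k by (simp add: field_simps)
  ultimately show "2 - 8 * ?L / real k \<le> sphere_average verts E b k"
    unfolding avg using pos by (simp add: pos_le_divide_eq)
qed

lemma sphere_average_tendsto:
  assumes "M = max (real q\<^sub>1) (real q\<^sub>2)"
  shows "sphere_average verts E b \<longlonglongrightarrow> 2"
proof (rule tendsto_sandwich)
  show "\<forall>\<^sub>F k in sequentially. 2 - 8 * suminf level_weight / real k \<le> sphere_average verts E b k"
    using eventually_gt_at_top[of 0] by eventually_elim (rule sphere_average_bounds(1)[OF assms])
  show "\<forall>\<^sub>F k in sequentially. sphere_average verts E b k \<le> 2"
    using eventually_gt_at_top[of 0] by eventually_elim (rule sphere_average_bounds(2)[OF assms])
  show "(\<lambda>k. 2 - 8 * suminf level_weight / real k) \<longlonglongrightarrow> 2"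
    using tendsto_diff[OF tendsto_const lim_const_over_n] by fastforce
qed simp

end

section \<open>Passage to Diestel-Leader graphs\<close>

theorem theorem8:
  fixes m n :: nat
    and V\<^sub>1 :: "'a set" and E\<^sub>1 :: "'a rel" and r\<^sub>1 :: "nat \<Rightarrow> 'a" and h\<^sub>1 :: "'a \<Rightarrow> int"
    and V\<^sub>2 :: "'b set" and E\<^sub>2 :: "'b rel" and r\<^sub>2 :: "nat \<Rightarrow> 'b" and h\<^sub>2 :: "'b \<Rightarrow> int"
  assumes "m \<ge> 2" and "n \<ge> 2"
    and "regular_tree V\<^sub>1 E\<^sub>1 (m + 1)" and "regular_tree V\<^sub>2 E\<^sub>2 (n + 1)"
    and "ray V\<^sub>1 E\<^sub>1 r\<^sub>1" and "ray V\<^sub>2 E\<^sub>2 r\<^sub>2"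
    and "horofunction V\<^sub>1 E\<^sub>1 r\<^sub>1 h\<^sub>1"
    and "horofunction V\<^sub>2 E\<^sub>2 r\<^sub>2 (\<lambda>v. - h\<^sub>2 v)"
  shows "statistically_hyperbolic (DL_verts V\<^sub>1 h\<^sub>1 V\<^sub>2 h\<^sub>2) (DL_edges V\<^sub>1 E\<^sub>1 h\<^sub>1 V\<^sub>2 E\<^sub>2 h\<^sub>2)"
proof -
  let ?V = "DL_verts V\<^sub>1 h\<^sub>1 V\<^sub>2 h\<^sub>2" and ?E = "DL_edges V\<^sub>1 E\<^sub>1 h\<^sub>1 V\<^sub>2 E\<^sub>2 h\<^sub>2"
  obtain p\<^sub>1 where p\<^sub>1: "horo_tree V\<^sub>1 p\<^sub>1 h\<^sub>1 m"
    "\<And>v w. (v, w) \<in> E\<^sub>1 \<longleftrightarrow> v \<in> V\<^sub>1 \<and> w \<in> V\<^sub>1 \<and> (p\<^sub>1 v = w \<or> p\<^sub>1 w = v)"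
    using regular_tree_horo_tree[OF assms(1,3,5,7)] by blast
  \<comment> \<open>The chosen end of the second tree is at plus infinity, so
    \<open>- h\<^sub>2\<close> decreases towards it and parents lie higher in
    \<open>h\<^sub>2\<close>.\<close>
  obtain p\<^sub>2 where p\<^sub>2: "horo_tree V\<^sub>2 p\<^sub>2 (\<lambda>v. - h\<^sub>2 v) n"
    "\<And>v w. (v, w) \<in> E\<^sub>2 \<longleftrightarrow> v \<in> V\<^sub>2 \<and> w \<in> V\<^sub>2 \<and> (p\<^sub>2 v = w \<or> p\<^sub>2 w = v)"
    using regular_tree_horo_tree[OF assms(2,4,6,8)] by blast
  interpret T1: horo_tree V\<^sub>1 p\<^sub>1 h\<^sub>1 m by (rule p\<^sub>1(1))
  interpret T2: horo_tree V\<^sub>2 p\<^sub>2 "\<lambda>v. - h\<^sub>2 v" n by (rule p\<^sub>2(1))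
  have V: "?V = {x \<in> V\<^sub>1 \<times> V\<^sub>2. h\<^sub>1 (fst x) + - h\<^sub>2 (snd x) = 0}"
    by (auto simp: DL_verts_def)
  have par: "h\<^sub>1 (p\<^sub>1 v) = h\<^sub>1 v - 1" "h\<^sub>2 (p\<^sub>2 w) = h\<^sub>2 w + 1" if "v \<in> V\<^sub>1" "w \<in> V\<^sub>2" for v w
    using T1.height_parent[OF that(1)] T2.height_parent[OF that(2)] by simp_all
  have edge: "(x, y) \<in> ?E \<longleftrightarrow> x \<in> V\<^sub>1 \<times> V\<^sub>2 \<and> y \<in> V\<^sub>1 \<times> V\<^sub>2 \<and>
     h\<^sub>1 (fst x) + - h\<^sub>2 (snd x) = 0 \<and> h\<^sub>1 (fst y) + - h\<^sub>2 (snd y) = 0 \<and>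
    (p\<^sub>1 (fst y) = fst x \<and> p\<^sub>2 (snd x) = snd y \<or> p\<^sub>1 (fst x) = fst y \<and> p\<^sub>2 (snd y) = snd x)" for x y
  proof (cases x; cases y)
    fix x1 x2 y1 y2 assume xy: "x = (x1, x2)" "y = (y1, y2)"
    \<comment> \<open>Parent steps in both trees at once would lower \<open>h\<^sub>1\<close> and
      raise \<open>h\<^sub>2\<close>, so an edge pairs a parent step with a child step.\<close>
    have "\<not> (p\<^sub>1 x1 = y1 \<and> p\<^sub>2 x2 = y2)" "\<not> (p\<^sub>1 y1 = x1 \<and> p\<^sub>2 y2 = x2)"
      if "x1 \<in> V\<^sub>1" "x2 \<in> V\<^sub>2" "y1 \<in> V\<^sub>1" "y2 \<in> V\<^sub>2" "h\<^sub>1 x1 = h\<^sub>2 x2" "h\<^sub>1 y1 = h\<^sub>2 y2"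
      using par[OF that(1,2)] par[OF that(3,4)] that(5,6) by auto
    then show ?thesis unfolding xy DL_edges_def DL_verts_def by (auto simp: p\<^sub>1(2) p\<^sub>2(2))
  qed
  have "sphere_average ?V ?E b \<longlonglongrightarrow> 2" if "b \<in> ?V" for b
  proof -
    interpret dl_graph V\<^sub>1 p\<^sub>1 h\<^sub>1 m V\<^sub>2 p\<^sub>2 "\<lambda>v. - h\<^sub>2 v" n b "max (real m) (real n)" ?E
      using that edge by unfold_locales (auto simp: V)
    show ?thesis unfolding V using sphere_average_tendsto by simp
  qed
  moreover have "?V \<noteq> {}"
  proof -
    obtain v w where "v \<in> V\<^sub>1" "w \<in> V\<^sub>2" using assms(5,6) by (auto simp: ray_def)
    moreover obtain u where "u \<in> V\<^sub>2" "- h\<^sub>2 u = - h\<^sub>1 v" using T2.ex_height[OF \<open>w \<in> V\<^sub>2\<close>] by blast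
    ultimately have "(v, u) \<in> ?V" by (simp add: DL_verts_def)
    then show ?thesis by blast
  qed
  ultimately show ?thesis by (simp add: statistically_hyperbolic_def has_sprawl_def)
qed

end
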